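(* Let $G$ be a topological group and let $p\colon E\to B$ be a $G$-fibration. For a $(G\times G)$-invariant (not necessarily open) subset $U$ of $E\times_{B/G}E$ the following are equivalent: 1. there exists a $(G\times G)$-equivariant section over $U$ of the map $\Psi\colon E^I_B\times_{E/G}E^I_B\to E\times_{B/G}E$, $\Psi(\gamma,\delta)=(\gamma(0),\delta(1))$; 2. there exists a $(G\times G)$-homotopy between the inclusion map $i_U\colon U\hookrightarrow E\times_{B/G}E$ and a $(G\times G)$-map $f\colon U\to E\times_{B/G}E$ which takes values in $E\times_{E/G}E$.
   Context: All spaces are Hausdorff, $I=[0,1]$, path spaces carry the compact-open topology. A $G$-map is a continuous equivariant map; a $G$-homotopy is an equivariant homotopy ($G$ acting trivially on $I$). A $G$-fibration is a $G$-map with the $G$-homotopy lifting property with respect to every $G$-space. For a $G$-fibration $p\colon E\to B$: $E^I_B$ is the space of paths $\gamma\colon I\to E$ whose image lies in a single fibre of $p$, with $(g\cdot\gamma)(t)=g\cdot\gamma(t)$; $E^I_B\times_{E/G}E^I_B=\{(\gamma,\delta)\in E^I_B\times E^I_B : G\cdot\gamma(1)=G\cdot\delta(0)\}$; $E\times_{B/G}E=\{(e_1,e_2)\in E\times E : G\cdot p(e_1)=G\cdot p(e_2)\}$; $E\times_{E/G}E=\{(e_1,e_2)\in E\times E: G\cdot e_1=G\cdot e_2\}\subseteq E\times_{B/G}E$. All carry the componentwise $(G\times G)$-action, and $\Psi$ is a $(G\times G)$-fibration. A section of $\Psi$ over $U$ is a continuous map $\sigma\colon U\to E^I_B\times_{E/G}E^I_B$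 with $\Psi\circ\sigma=i_U$. *)

theory Defs
  imports "HOL-Analysis.Analysis" "HOL-Algebra.Group_Action"
begin

section \<open>Topological groups and \<open>G\<close>-spaces\<close>

text \<open>All spaces are Hausdorff: this is part of being a topological group and of being a
  \<open>G\<close>-space.\<close>

definition topological_group :: "('g, 'm) monoid_scheme \<Rightarrow> 'g topology \<Rightarrow> bool" where
  "topological_group G T \<longleftrightarrow>
     group G \<and> topspace T = carrier G \<and> Hausdorff_space T \<and>
     continuous_map (prod_topology T T) T (\<lambda>(g, h). g \<otimes>\<^bsub>G\<^esub> h) \<and>
     continuous_map T T (\<lambda>g. inv\<^bsub>G\<^esub> g)"

text \<open>An action is a function \<open>a g x\<close> of which only the values for \<open>g \<in> carrier G\<close> and
  \<open>x \<in> topspace X\<close> matter. (\<^const>\<open>group_action\<close> would in addition require \<open>a g\<close> to be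
  \<^const>\<open>undefined\<close> outside of \<open>topspace X\<close>.)\<close>

definition G_space ::
  "('g, 'm) monoid_scheme \<Rightarrow> 'g topology \<Rightarrow> 'x topology \<Rightarrow> ('g \<Rightarrow> 'x \<Rightarrow> 'x) \<Rightarrow> bool" where
  "G_space G T X a \<longleftrightarrow>
     Hausdorff_space X \<and>
     continuous_map (prod_topology T X) X (\<lambda>(g, x). a g x) \<and>
     (\<forall>x \<in> topspace X. a \<one>\<^bsub>G\<^esub> x = x) \<and>
     (\<forall>g \<in> carrier G. \<forall>h \<in> carrier G. \<forall>x \<in> topspace X. a (g \<otimes>\<^bsub>G\<^esub> h) x = a g (a h x))"

definition equivariant ::
  "('g, 'm) monoid_scheme \<Rightarrow> 'x topology \<Rightarrow> ('g \<Rightarrow> 'x \<Rightarrow> 'x) \<Rightarrow> ('g \<Rightarrow> 'y \<Rightarrow> 'y) \<Rightarrow> ('x \<Rightarrow> 'y) \<Rightarrow> bool" where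
  "equivariant G X a b f \<longleftrightarrow> (\<forall>g \<in> carrier G. \<forall>x \<in> topspace X. f (a g x) = b g (f x))"

definition G_map ::
  "('g, 'm) monoid_scheme \<Rightarrow> 'x topology \<Rightarrow> ('g \<Rightarrow> 'x \<Rightarrow> 'x) \<Rightarrow> 'y topology \<Rightarrow> ('g \<Rightarrow> 'y \<Rightarrow> 'y)
     \<Rightarrow> ('x \<Rightarrow> 'y) \<Rightarrow> bool" where
  "G_map G X a Y b f \<longleftrightarrow> continuous_map X Y f \<and> equivariant G X a b f"

definition G_invariant :: "('g, 'm) monoid_scheme \<Rightarrow> ('g \<Rightarrow> 'x \<Rightarrow> 'x) \<Rightarrow> 'x set \<Rightarrow> bool" where
  "G_invariant G a U \<longleftrightarrow> (\<forall>g \<in> carrier G. \<forall>x \<in> U. a g x \<in> U)"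


section \<open>\<open>G\<close>-homotopies and \<open>G\<close>-fibrations\<close>

text \<open>As for \<^const>\<open>homotopic_with\<close>, homotopies are maps on \<open>I \<times> X\<close>.\<close>

abbreviation unit_interval :: "real topology" where
  "unit_interval \<equiv> top_of_set {0..1}"

definition cylinder_action :: "('g \<Rightarrow> 'x \<Rightarrow> 'x) \<Rightarrow> 'g \<Rightarrow> real \<times> 'x \<Rightarrow> real \<times> 'x" where
  "cylinder_action a g = (\<lambda>(t, x). (t, a g x))"

text \<open>As \<open>G\<close> acts trivially on \<open>I\<close>, a homotopy is equivariant iff each of its stages is.\<close>

definition G_homotopic ::
  "('g, 'm) monoid_scheme \<Rightarrow> 'x topology \<Rightarrow> ('g \<Rightarrow> 'x \<Rightarrow> 'x) \<Rightarrow> 'y topology \<Rightarrow> ('g \<Rightarrow> 'y \<Rightarrow> 'y)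
     \<Rightarrow> ('x \<Rightarrow> 'y) \<Rightarrow> ('x \<Rightarrow> 'y) \<Rightarrow> bool" where
  "G_homotopic G X a Y b = homotopic_with (equivariant G X a b) X Y"

definition G_homotopy_lifting ::
  "'x itself \<Rightarrow> ('g, 'm) monoid_scheme \<Rightarrow> 'g topology \<Rightarrow> 'e topology \<Rightarrow> ('g \<Rightarrow> 'e \<Rightarrow> 'e)
     \<Rightarrow> 'b topology \<Rightarrow> ('g \<Rightarrow> 'b \<Rightarrow> 'b) \<Rightarrow> ('e \<Rightarrow> 'b) \<Rightarrow> bool" where
  "G_homotopy_lifting TYPE('x) G T E aE B aB p \<longleftrightarrow>
     (\<forall>(X :: 'x topology) a f h.
        G_space G T X a \<longrightarrow>
        G_map G X a E aE f \<longrightarrow>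
        G_map G (prod_topology unit_interval X) (cylinder_action a) B aB h \<longrightarrow>
        (\<forall>x \<in> topspace X. h (0, x) = p (f x)) \<longrightarrow>
        (\<exists>k. G_map G (prod_topology unit_interval X) (cylinder_action a) E aE k \<and>
             (\<forall>x \<in> topspace X. k (0, x) = f x) \<and>
             (\<forall>t \<in> {0..1}. \<forall>x \<in> topspace X. p (k (t, x)) = h (t, x))))"

text \<open>A definition cannot quantify over the types carrying the test spaces. The type
  \<open>'e \<times> (real \<Rightarrow> 'b)\<close> is large enough to carry the universal test space
  \<open>{(e, \<gamma>) \<in> E \<times> B\<^sup>I. \<gamma> 0 = p e}\<close>, so that the lifting property for \<open>G\<close>-spaces on this type
  implies the one for \<open>G\<close>-spaces on every other type; this is
  \<open>G_fibration_imp_G_homotopy_lifting\<close> below.\<close>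

definition G_fibration ::
  "('g, 'm) monoid_scheme \<Rightarrow> 'g topology \<Rightarrow> 'e topology \<Rightarrow> ('g \<Rightarrow> 'e \<Rightarrow> 'e)
     \<Rightarrow> 'b topology \<Rightarrow> ('g \<Rightarrow> 'b \<Rightarrow> 'b) \<Rightarrow> ('e \<Rightarrow> 'b) \<Rightarrow> bool" where
  "G_fibration G T (E :: 'e topology) aE (B :: 'b topology) aB p \<longleftrightarrow>
     G_space G T E aE \<and> G_space G T B aB \<and> G_map G E aE B aB p \<and>
     G_homotopy_lifting TYPE('e \<times> (real \<Rightarrow> 'b)) G T E aE B aB p"


section \<open>Path spaces\<close>

text \<open>The set of continuous maps \<open>X \<rightarrow> Y\<close> with the compact-open topology; maps are normalised to be
  \<^const>\<open>undefined\<close> outside of \<open>topspace X\<close>.\<close>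

definition continuous_maps :: "'a topology \<Rightarrow> 'b topology \<Rightarrow> ('a \<Rightarrow> 'b) set" where
  "continuous_maps X Y = {f \<in> extensional (topspace X). continuous_map X Y f}"

definition compact_open_topology :: "'a topology \<Rightarrow> 'b topology \<Rightarrow> ('a \<Rightarrow> 'b) topology" where
  "compact_open_topology X Y =
     topology_generated_by {{f \<in> continuous_maps X Y. f ` K \<subseteq> V} |K V. compactin X K \<and> openin Y V}"

abbreviation path_space :: "'a topology \<Rightarrow> (real \<Rightarrow> 'a) topology" where
  "path_space X \<equiv> compact_open_topology unit_interval X"

definition path_action :: "('g \<Rightarrow> 'x \<Rightarrow> 'x) \<Rightarrow> 'g \<Rightarrow> (real \<Rightarrow> 'x) \<Rightarrow> (real \<Rightarrow> 'x)" where
  "path_action a g \<gamma> = (\<lambda>t\<in>{0..1}. a g (\<gamma> t))"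

definition prod_action :: "('g \<Rightarrow> 'x \<Rightarrow> 'x) \<Rightarrow> ('h \<Rightarrow> 'y \<Rightarrow> 'y) \<Rightarrow> 'g \<times> 'h \<Rightarrow> 'x \<times> 'y \<Rightarrow> 'x \<times> 'y" where
  "prod_action a b = (\<lambda>(g, h) (x, y). (a g x, b h y))"

text \<open>\<open>E\<^sup>I\<^sub>B\<close>\<close>

definition fibre_paths :: "'e topology \<Rightarrow> 'b topology \<Rightarrow> ('e \<Rightarrow> 'b) \<Rightarrow> (real \<Rightarrow> 'e) topology" where
  "fibre_paths E B p =
     subtopology (path_space E) {\<gamma>. \<exists>b \<in> topspace B. \<forall>t \<in> {0..1}. p (\<gamma> t) = b}"

text \<open>\<open>E\<^sup>I\<^sub>B \<times>\<^bsub>E/G\<^esub> E\<^sup>I\<^sub>B\<close>\<close>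

definition broken_fibre_paths ::
  "('g, 'm) monoid_scheme \<Rightarrow> 'e topology \<Rightarrow> ('g \<Rightarrow> 'e \<Rightarrow> 'e) \<Rightarrow> 'b topology \<Rightarrow> ('e \<Rightarrow> 'b)
     \<Rightarrow> ((real \<Rightarrow> 'e) \<times> (real \<Rightarrow> 'e)) topology" where
  "broken_fibre_paths G E aE B p =
     subtopology (prod_topology (fibre_paths E B p) (fibre_paths E B p))
       {(\<gamma>, \<delta>). orbit G aE (\<gamma> 1) = orbit G aE (\<delta> 0)}"

text \<open>\<open>E \<times>\<^bsub>B/G\<^esub> E\<close> and \<open>E \<times>\<^bsub>E/G\<^esub> E\<close>\<close>

definition same_base_orbit ::
  "('g, 'm) monoid_scheme \<Rightarrow> 'e topology \<Rightarrow> ('g \<Rightarrow> 'b \<Rightarrow> 'b) \<Rightarrow> ('e \<Rightarrow> 'b) \<Rightarrow> ('e \<times> 'e) topology" where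
  "same_base_orbit G E aB p =
     subtopology (prod_topology E E) {(e1, e2). orbit G aB (p e1) = orbit G aB (p e2)}"

definition same_orbit ::
  "('g, 'm) monoid_scheme \<Rightarrow> 'e topology \<Rightarrow> ('g \<Rightarrow> 'e \<Rightarrow> 'e) \<Rightarrow> ('e \<times> 'e) topology" where
  "same_orbit G E aE =
     subtopology (prod_topology E E) {(e1, e2). orbit G aE e1 = orbit G aE e2}"

definition Psi :: "(real \<Rightarrow> 'e) \<times> (real \<Rightarrow> 'e) \<Rightarrow> 'e \<times> 'e" where
  "Psi = (\<lambda>(\<gamma>, \<delta>). (\<gamma> 0, \<delta> 1))"


section \<open>The lifting property for test spaces on arbitrary types\<close>

lemma topspace_compact_open [simp]:
  "topspace (compact_open_topology X Y) = continuous_maps X Y"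
proof -
  have "continuous_maps X Y \<in> {{f \<in> continuous_maps X Y. f ` K \<subseteq> V} |K V. compactin X K \<and> openin Y V}"
    by (rule CollectI, rule exI[of _ "{}"], rule exI[of _ "{}"]) auto
  then show ?thesis
    unfolding compact_open_topology_def topology_generated_by_topspace by blast
qed

lemma openin_compact_open_subbasis:
  assumes "compactin X K" "openin Y V"
  shows "openin (compact_open_topology X Y) {f \<in> continuous_maps X Y. f ` K \<subseteq> V}"
  unfolding compact_open_topology_def
  by (rule topology_generated_by_Basis) (use assms in blast)

lemma continuous_map_curry:
  assumes h: "continuous_map (prod_topology X Z) Y h"
  shows "continuous_map Z (compact_open_topology X Y) (\<lambda>z. \<lambda>x\<in>topspace X. h (x, z))"
    (is "continuous_map Z _ ?F")
  unfolding compact_open_topology_def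
proof (rule continuous_on_generated_topo)
  have F: "?F z \<in> continuous_maps X Y" if "z \<in> topspace Z" for z
  proof -
    have "continuous_map X Y (h \<circ> (\<lambda>x. (x, z)))"
      using that by (intro continuous_map_compose[OF _ h] continuous_map_pairedI) auto
    then have "continuous_map X Y (?F z)"
      by (rule continuous_map_eq) auto
    then show ?thesis by (simp add: continuous_maps_def)
  qed
  have *: "topology_generated_by {{f \<in> continuous_maps X Y. f ` K \<subseteq> V} |K V. compactin X K \<and> openin Y V}
      = compact_open_topology X Y"
    by (simp add: compact_open_topology_def)
  show "?F ` topspace Z \<subseteq> \<Union>{{f \<in> continuous_maps X Y. f ` K \<subseteq> V} |K V. compactin X K \<and> openin Y V}"
    using F topology_generated_by_topspace[of "{{f \<in> continuous_maps X Y. f ` K \<subseteq> V} |K V. compactin X K \<and> openin Y V}"]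
    unfolding * by auto
  fix U assume "U \<in> {{f \<in> continuous_maps X Y. f ` K \<subseteq> V} |K V. compactin X K \<and> openin Y V}"
  then obtain K V where U: "U = {f \<in> continuous_maps X Y. f ` K \<subseteq> V}"
    and K: "compactin X K" and V: "openin Y V" by blast
  have KX: "K \<subseteq> topspace X" using K compactin_subset_topspace by blast
  let ?W = "{w \<in> topspace (prod_topology X Z). h w \<in> V}"
  have W: "openin (prod_topology X Z) ?W"
    using h V by (rule openin_continuous_map_preimage)
  show "openin Z (?F -` U \<inter> topspace Z)"
  proof (subst openin_subopen, intro ballI)
    fix z assume z: "z \<in> ?F -` U \<inter> topspace Z"
    then have "K \<times> {z} \<subseteq> ?W" using KX by (auto simp: U subset_iff)
    then obtain A C where AC: "openin X A" "openin Z C" "K \<subseteq> A" "{z} \<subseteq> C" "A \<times> C \<subseteq> ?W"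
      using Wallace_theorem_prod_topology[OF K _ W, of "{z}"] z by auto
    have "C \<subseteq> ?F -` U \<inter> topspace Z"
    proof
      fix c assume c: "c \<in> C"
      then have cZ: "c \<in> topspace Z" using AC(2) openin_subset by blast
      have "?F c ` K \<subseteq> V" using AC(3,5) c KX by auto
      then show "c \<in> ?F -` U \<inter> topspace Z" using F[OF cZ] cZ by (simp add: U)
    qed
    then show "\<exists>T. openin Z T \<and> z \<in> T \<and> T \<subseteq> ?F -` U \<inter> topspace Z"
      using AC by blast
  qed
qed

lemma continuous_map_evaluation:
  assumes X: "locally_compact_space X" "Hausdorff_space X"
  shows "continuous_map (prod_topology X (compact_open_topology X Y)) Y (\<lambda>(x, f). f x)"
proof (subst continuous_map_def, intro conjI allI impI)
  show "(\<lambda>(x, f). f x) \<in> topspace (prod_topology X (compact_open_topology X Y)) \<rightarrow> topspace Y"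
    by (auto simp: continuous_maps_def continuous_map_def)
  fix V assume V: "openin Y V"
  let ?S = "{w \<in> topspace (prod_topology X (compact_open_topology X Y)). (case w of (x, f) \<Rightarrow> f x) \<in> V}"
  have nb: "neighbourhood_base_of (compactin X) X"
    using X locally_compact_space_neighbourhood_base by blast
  show "openin (prod_topology X (compact_open_topology X Y)) ?S"
  proof (subst openin_subopen, intro ballI)
    fix w assume "w \<in> ?S"
    then obtain x f where w: "w = (x, f)" "x \<in> topspace X" "f \<in> continuous_maps X Y" "f x \<in> V"
      by auto
    have "openin X {x \<in> topspace X. f x \<in> V}"
      using w V by (intro openin_continuous_map_preimage[of X Y]) (auto simp: continuous_maps_def)
    moreover have "x \<in> {x \<in> topspace X. f x \<in> V}" using w by simp
    ultimately obtain A K where AK: "openin X A" "compactin X K" "x \<in> A" "A \<subseteq> K"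
        "K \<subseteq> {x \<in> topspace X. f x \<in> V}"
      using nb unfolding neighbourhood_base_of by meson
    let ?N = "A \<times> {f \<in> continuous_maps X Y. f ` K \<subseteq> V}"
    have "openin (prod_topology X (compact_open_topology X Y)) ?N"
      using AK(1) openin_compact_open_subbasis[OF AK(2) V] by (simp add: openin_prod_Times_iff)
    moreover have "w \<in> ?N" using w AK by auto
    moreover have "?N \<subseteq> ?S" using AK by auto
    ultimately show "\<exists>T. openin (prod_topology X (compact_open_topology X Y)) T \<and> w \<in> T \<and> T \<subseteq> ?S"
      by blast
  qed
qed

lemma Hausdorff_space_compact_open:
  assumes Y: "Hausdorff_space Y"
  shows "Hausdorff_space (compact_open_topology X Y)"
  unfolding Hausdorff_space_def
proof (intro allI impI)
  fix f g assume "f \<in> topspace (compact_open_topology X Y) \<and> g \<in> topspace (compact_open_topology X Y) \<and> f \<noteq> g"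
  then have fg: "f \<in> continuous_maps X Y" "g \<in> continuous_maps X Y" "f \<noteq> g" by auto
  then obtain x where x: "x \<in> topspace X" "f x \<noteq> g x"
    unfolding continuous_maps_def by (metis (no_types, lifting) extensionalityI mem_Collect_eq)
  have "f x \<in> topspace Y" "g x \<in> topspace Y"
    using fg x by (auto simp: continuous_maps_def continuous_map_def)
  then obtain A C where AC: "openin Y A" "openin Y C" "f x \<in> A" "g x \<in> C" "disjnt A C"
    using Y x unfolding Hausdorff_space_def by metis
  have K: "compactin X {x}" using x by simp
  let ?N = "\<lambda>V. {f \<in> continuous_maps X Y. f ` {x} \<subseteq> V}"
  have "f \<in> ?N A" "g \<in> ?N C" "disjnt (?N A) (?N C)"
    using fg AC by (auto simp: disjnt_iff)
  then show "\<exists>U V. openin (compact_open_topology X Y) U \<and> openin (compact_open_topology X Y) V \<and>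
      f \<in> U \<and> g \<in> V \<and> disjnt U V"
    using openin_compact_open_subbasis[OF K AC(1)] openin_compact_open_subbasis[OF K AC(2)] by blast
qed

lemma continuous_map_path_evaluation:
  "continuous_map (prod_topology unit_interval (path_space X)) X (\<lambda>(t, \<gamma>). \<gamma> t)"
proof (rule continuous_map_evaluation)
  have "compact_space unit_interval"
    by (simp add: compact_space_subtopology)
  then show "locally_compact_space unit_interval"
    by (rule compact_imp_locally_compact_space)
  show "Hausdorff_space unit_interval"
    by (simp add: Hausdorff_space_subtopology)
qed

lemma G_space_path_space:
  assumes G: "topological_group G T" and X: "G_space G T X a"
  shows "G_space G T (path_space X) (path_action a)"
  unfolding G_space_def
proof (intro conjI ballI)
  let ?TP = "prod_topology T (path_space X)"
  have T: "topspace T = carrier G" using G by (simp add: topological_group_def)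
  show "Hausdorff_space (path_space X)"
    using X by (simp add: G_space_def Hausdorff_space_compact_open)
  have 1: "continuous_map (prod_topology unit_interval ?TP) T (fst \<circ> snd)"
    by (rule continuous_map_compose[OF continuous_map_snd continuous_map_fst])
  have "continuous_map (prod_topology unit_interval ?TP) (prod_topology unit_interval (path_space X))
      (\<lambda>w. (fst w, (snd \<circ> snd) w))"
    by (intro continuous_map_pairedI continuous_map_fst
        continuous_map_compose[OF continuous_map_snd continuous_map_snd])
  from continuous_map_compose[OF this continuous_map_path_evaluation]
  have 2: "continuous_map (prod_topology unit_interval ?TP) X (\<lambda>w. snd (snd w) (fst w))"
    by (simp add: o_def case_prod_unfold)
  have 3: "continuous_map (prod_topology T X) X (\<lambda>(g, x). a g x)"
    using X by (simp add: G_space_def)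
  have "continuous_map (prod_topology unit_interval ?TP) X (\<lambda>w. a (fst (snd w)) (snd (snd w) (fst w)))"
    using continuous_map_compose[OF continuous_map_pairedI[OF 1 2] 3] by (simp add: o_def)
  from continuous_map_curry[OF this]
  show "continuous_map ?TP (path_space X) (\<lambda>(g, \<gamma>). path_action a g \<gamma>)"
    by (simp add: path_action_def case_prod_unfold)
  fix \<gamma> assume "\<gamma> \<in> topspace (path_space X)"
  then have \<gamma>: "\<gamma> \<in> extensional {0..1}" "\<And>t. t \<in> {0..1} \<Longrightarrow> \<gamma> t \<in> topspace X"
    by (auto simp: continuous_maps_def continuous_map_def)
  show "path_action a \<one>\<^bsub>G\<^esub> \<gamma> = \<gamma>"
    using X \<gamma> by (intro extensionalityI[of _ "{0..1}"]) (auto simp: path_action_def G_space_def)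
  fix g h assume "g \<in> carrier G" "h \<in> carrier G"
  then show "path_action a (g \<otimes>\<^bsub>G\<^esub> h) \<gamma> = path_action a g (path_action a h \<gamma>)"
    using X \<gamma> by (auto simp: path_action_def G_space_def fun_eq_iff)
qed

lemma G_space_subtopology:
  assumes G: "topological_group G T" and X: "G_space G T X a"
    and S: "\<And>g x. \<lbrakk>g \<in> carrier G; x \<in> topspace X; x \<in> S\<rbrakk> \<Longrightarrow> a g x \<in> S"
  shows "G_space G T (subtopology X S) a"
  unfolding G_space_def
proof (intro conjI ballI)
  have T: "topspace T = carrier G" using G by (simp add: topological_group_def)
  show "Hausdorff_space (subtopology X S)"
    using X by (simp add: G_space_def Hausdorff_space_subtopology)
  have "continuous_map (prod_topology T (subtopology X S)) X (\<lambda>(g, x). a g x)"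
    unfolding prod_topology_subtopology using X
    by (intro continuous_map_from_subtopology) (simp add: G_space_def)
  then show "continuous_map (prod_topology T (subtopology X S)) (subtopology X S) (\<lambda>(g, x). a g x)"
    using S T by (auto simp: continuous_map_in_subtopology)
qed (use X in \<open>auto simp: G_space_def\<close>)

lemma G_space_lifting_data:
  assumes G: "topological_group G T" and E: "G_space G T E aE" and B: "G_space G T B aB"
    and p: "G_map G E aE B aB p"
  shows "G_space G T (subtopology (prod_topology E (path_space B)) {(e, \<gamma>). \<gamma> 0 = p e})
           (\<lambda>g (e, \<gamma>). (aE g e, path_action aB g \<gamma>))"
proof (rule G_space_subtopology[OF G])
  let ?P = "prod_topology E (path_space B)"
  note PB = G_space_path_space[OF G B]
  have c1: "continuous_map (prod_topology T ?P) T fst" by (rule continuous_map_fst)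
  have c2: "continuous_map (prod_topology T ?P) E (\<lambda>w. fst (snd w))"
    using continuous_map_compose[OF continuous_map_snd continuous_map_fst] by (simp add: o_def)
  have c3: "continuous_map (prod_topology T ?P) (path_space B) (\<lambda>w. snd (snd w))"
    using continuous_map_compose[OF continuous_map_snd continuous_map_snd] by (simp add: o_def)
  have e: "continuous_map (prod_topology T ?P) E (\<lambda>w. aE (fst w) (fst (snd w)))"
    using continuous_map_compose[OF continuous_map_pairedI[OF c1 c2], of E "\<lambda>(g, x). aE g x"] E
    by (simp add: o_def G_space_def)
  have b: "continuous_map (prod_topology T ?P) (path_space B) (\<lambda>w. path_action aB (fst w) (snd (snd w)))"
    using continuous_map_compose[OF continuous_map_pairedI[OF c1 c3], of "path_space B" "\<lambda>(g, x). path_action aB g x"] PB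
    by (simp add: o_def G_space_def)
  show "G_space G T ?P (\<lambda>g (e, \<gamma>). (aE g e, path_action aB g \<gamma>))"
    using continuous_map_pairedI[OF e b] E PB
    unfolding G_space_def by (auto simp: case_prod_unfold Hausdorff_space_prod_topology)
  fix g x assume "g \<in> carrier G" "x \<in> topspace ?P" "x \<in> {(e, \<gamma>). \<gamma> 0 = p e}"
  then show "(case x of (e, \<gamma>) \<Rightarrow> (aE g e, path_action aB g \<gamma>)) \<in> {(e, \<gamma>). \<gamma> 0 = p e}"
    using p by (auto simp: path_action_def G_map_def equivariant_def)
qed

theorem G_fibration_imp_G_homotopy_lifting:
  fixes E :: "'e topology" and B :: "'b topology"
  assumes G: "topological_group G T" and fib: "G_fibration G T E aE B aB p"
  shows "G_homotopy_lifting TYPE('x) G T E aE B aB p"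
  unfolding G_homotopy_lifting_def
proof (intro allI impI)
  fix X :: "'x topology" and a f h
  assume X: "G_space G T X a" and f: "G_map G X a E aE f"
    and h: "G_map G (prod_topology unit_interval X) (cylinder_action a) B aB h"
    and hf: "\<forall>x \<in> topspace X. h (0, x) = p (f x)"
  have T: "topspace T = carrier G" using G by (simp add: topological_group_def)
  have E: "G_space G T E aE" and B: "G_space G T B aB" and p: "G_map G E aE B aB p"
    and lift: "G_homotopy_lifting TYPE('e \<times> (real \<Rightarrow> 'b)) G T E aE B aB p"
    using fib by (auto simp: G_fibration_def)
  define N where "N = subtopology (prod_topology E (path_space B)) {(e, \<gamma>). \<gamma> 0 = p e}"
  define aN where "aN = (\<lambda>g (e, \<gamma>). (aE g e, path_action aB g \<gamma>))"
  have N: "G_space G T N aN"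
    unfolding N_def aN_def by (rule G_space_lifting_data[OF G E B p])
  have sndN: "continuous_map N (path_space B) snd"
    unfolding N_def by (intro continuous_map_from_subtopology continuous_map_snd)
  have fN: "G_map G N aN E aE fst"
    unfolding G_map_def equivariant_def
    by (auto simp: N_def aN_def intro!: continuous_map_from_subtopology continuous_map_fst)
  let ?h = "\<lambda>(t, n). snd n t"
  have "continuous_map (prod_topology unit_interval N) B ((\<lambda>(t, \<gamma>). \<gamma> t) \<circ> (\<lambda>w. (fst w, (snd \<circ> snd) w)))"
    by (intro continuous_map_compose[OF _ continuous_map_path_evaluation] continuous_map_pairedI
        continuous_map_fst continuous_map_compose[OF continuous_map_snd sndN])
  then have hN: "G_map G (prod_topology unit_interval N) (cylinder_action aN) B aB ?h"
    by (auto simp: G_map_def equivariant_def o_def case_prod_unfold cylinder_action_def aN_def path_action_def)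
  have "\<forall>n \<in> topspace N. ?h (0, n) = p (fst n)"
    by (auto simp: N_def)
  then obtain k where k: "G_map G (prod_topology unit_interval N) (cylinder_action aN) E aE k"
    and k0: "\<forall>n \<in> topspace N. k (0, n) = fst n"
    and pk: "\<forall>t \<in> {0..1}. \<forall>n \<in> topspace N. p (k (t, n)) = ?h (t, n)"
    using lift N fN hN unfolding G_homotopy_lifting_def by blast
  define \<phi> where "\<phi> = (\<lambda>x. (f x, \<lambda>t\<in>{0..1}. h (t, x)))"
  have cf: "continuous_map X E f" using f by (simp add: G_map_def)
  have ch: "continuous_map X (path_space B) (\<lambda>x. \<lambda>t\<in>{0..1}. h (t, x))"
    using continuous_map_curry[of unit_interval X B h] h by (simp add: G_map_def)
  have c\<phi>: "continuous_map X N \<phi>"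
    unfolding N_def \<phi>_def continuous_map_in_subtopology
    using continuous_map_pairedI[OF cf ch] hf by auto
  then have \<phi>N: "\<phi> x \<in> topspace N" if "x \<in> topspace X" for x
    using that by (auto simp: continuous_map_def)
  have e\<phi>: "\<phi> (a g x) = aN g (\<phi> x)" if "g \<in> carrier G" "x \<in> topspace X" for g x
    using that f h
    by (auto simp: \<phi>_def aN_def path_action_def G_map_def equivariant_def cylinder_action_def fun_eq_iff)
  have ck: "continuous_map (prod_topology unit_interval X) E (\<lambda>w. k (fst w, \<phi> (snd w)))"
  proof -
    have "continuous_map (prod_topology unit_interval X) (prod_topology unit_interval N)
        (\<lambda>w. (fst w, (\<phi> \<circ> snd) w))"
      by (intro continuous_map_pairedI continuous_map_fst continuous_map_compose[OF continuous_map_snd c\<phi>])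
    then show ?thesis
      using continuous_map_compose[of _ _ _ E k] k by (fastforce simp: G_map_def o_def)
  qed
  show "\<exists>k. G_map G (prod_topology unit_interval X) (cylinder_action a) E aE k \<and>
             (\<forall>x \<in> topspace X. k (0, x) = f x) \<and>
             (\<forall>t \<in> {0..1}. \<forall>x \<in> topspace X. p (k (t, x)) = h (t, x))"
  proof (intro exI conjI ballI)
    show "G_map G (prod_topology unit_interval X) (cylinder_action a) E aE (\<lambda>w. k (fst w, \<phi> (snd w)))"
      using ck k \<phi>N e\<phi> unfolding G_map_def equivariant_def by (auto simp: cylinder_action_def)
  qed (use k0 pk \<phi>N in \<open>auto simp: \<phi>_def\<close>)
qed

end

theory Submission
  imports Defs
begin

text \<open>A pair \<open>(\<gamma>, \<delta>)\<close> of fibrewise paths with \<open>\<gamma> 1\<close> and \<open>\<delta> 0\<close> in one orbit can be shrunk: run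
  through \<open>\<gamma>\<close> forwards and through \<open>\<delta>\<close> backwards. This is a homotopy
  \<open>(t, (\<gamma>, \<delta>)) \<mapsto> (\<gamma> t, \<delta> (1 - t))\<close> from \<open>\<Psi>\<close> to the midpoint map \<open>(\<gamma>, \<delta>) \<mapsto> (\<gamma> 1, \<delta> 0)\<close>, whose values
  lie in \<open>E \<times>\<^bsub>E/G\<^esub> E\<close>; since the paths stay in fibres, it never leaves \<open>E \<times>\<^bsub>B/G\<^esub> E\<close>
  (\<open>Psi_G_homotopic_midpoints\<close>). Precomposing it with a section \<open>\<sigma>\<close> of \<open>\<Psi>\<close> over \<open>U\<close> deforms
  \<open>\<Psi> \<circ> \<sigma> = i\<^sub>U\<close> into \<open>E \<times>\<^bsub>E/G\<^esub> E\<close>.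

  Conversely, over \<open>E \<times>\<^bsub>E/G\<^esub> E\<close> the map \<open>\<Psi>\<close> has a canonical section, which sends a pair of points to the
  pair of constant paths (\<open>G_map_const_paths\<close>). So a map \<open>f\<close> with values there lifts along \<open>\<Psi>\<close>, and
  as \<open>\<Psi>\<close> is a fibration, every map homotopic to \<open>f\<close> lifts too (\<open>G_homotopic_lift\<close>). Lifts of \<open>i\<^sub>U\<close>
  are sections over \<open>U\<close>.\<close>

section \<open>Equivariant maps and homotopies\<close>

lemma topological_group_DirProd:
  assumes G: "topological_group G S" and H: "topological_group H T"
  shows "topological_group (G \<times>\<times> H) (prod_topology S T)"
proof -
  let ?P = "prod_topology S T"
  let ?PP = "prod_topology ?P ?P"
  have gG: "group G" and gH: "group H"
    and mG: "continuous_map (prod_topology S S) S (\<lambda>(g, h). g \<otimes>\<^bsub>G\<^esub> h)"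
    and mH: "continuous_map (prod_topology T T) T (\<lambda>(g, h). g \<otimes>\<^bsub>H\<^esub> h)"
    and iG: "continuous_map S S (\<lambda>g. inv\<^bsub>G\<^esub> g)" and iH: "continuous_map T T (\<lambda>g. inv\<^bsub>H\<^esub> g)"
    and car: "topspace S = carrier G" "topspace T = carrier H"
    using G H by (auto simp: topological_group_def)
  have "continuous_map ?PP (prod_topology S S) (\<lambda>w. ((fst \<circ> fst) w, (fst \<circ> snd) w))"
    by (intro continuous_map_pairedI continuous_map_compose[OF continuous_map_fst continuous_map_fst]
        continuous_map_compose[OF continuous_map_snd continuous_map_fst])
  note m1 = continuous_map_compose[OF this mG]
  have "continuous_map ?PP (prod_topology T T) (\<lambda>w. ((snd \<circ> fst) w, (snd \<circ> snd) w))"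
    by (intro continuous_map_pairedI continuous_map_compose[OF continuous_map_fst continuous_map_snd]
        continuous_map_compose[OF continuous_map_snd continuous_map_snd])
  note m2 = continuous_map_compose[OF this mH]
  have mult: "continuous_map ?PP ?P (\<lambda>(g, h). g \<otimes>\<^bsub>G \<times>\<times> H\<^esub> h)"
    using continuous_map_pairedI[OF m1 m2] by (simp add: o_def case_prod_unfold DirProd_def)
  have "continuous_map ?P ?P (\<lambda>w. (((\<lambda>g. inv\<^bsub>G\<^esub> g) \<circ> fst) w, ((\<lambda>g. inv\<^bsub>H\<^esub> g) \<circ> snd) w))"
    by (intro continuous_map_pairedI continuous_map_compose[OF continuous_map_fst iG]
        continuous_map_compose[OF continuous_map_snd iH])
  then have "continuous_map ?P ?P (\<lambda>g. inv\<^bsub>G \<times>\<times> H\<^esub> g)"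
    by (rule continuous_map_eq) (auto simp: car inv_DirProd[OF gG gH])
  with mult show ?thesis
    using G H gG gH
    by (auto simp: topological_group_def DirProd_group Hausdorff_space_prod_topology)
qed

lemma G_space_action_closed:
  assumes "topological_group G T" "G_space G T X a" "g \<in> carrier G" "x \<in> topspace X"
  shows "a g x \<in> topspace X"
  using assms by (auto simp: topological_group_def G_space_def continuous_map_def Pi_iff)

lemma G_map_compose:
  assumes f: "G_map G X a Y b f" and g: "G_map G Y b Z c g"
  shows "G_map G X a Z c (g \<circ> f)"
  using assms continuous_map_compose[of X Y f Z g]
  by (auto simp: G_map_def equivariant_def continuous_map_def Pi_iff)

text \<open>Equivariance only depends on the values of a map on the space, because the action does not lead
  out of it.\<close>

lemma equivariant_cong:
  assumes "topological_group G T" "G_space G T X a" "\<And>x. x \<in> topspace X \<Longrightarrow> f x = f' x"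
  shows "equivariant G X a b f \<longleftrightarrow> equivariant G X a b f'"
  using assms G_space_action_closed[OF assms(1,2)] by (simp add: equivariant_def)

lemma G_homotopic_iff:
  assumes "topological_group G T" "G_space G T X a"
  shows "G_homotopic G X a Y b f0 f1 \<longleftrightarrow>
    (\<exists>h. G_map G (prod_topology unit_interval X) (cylinder_action a) Y b h \<and>
         (\<forall>x \<in> topspace X. h (0, x) = f0 x) \<and> (\<forall>x \<in> topspace X. h (1, x) = f1 x))"
proof -
  have stages: "(\<forall>t \<in> {0..1}. equivariant G X a b (\<lambda>x. h (t, x))) \<longleftrightarrow>
      equivariant G (prod_topology unit_interval X) (cylinder_action a) b h" for h
    by (auto simp: equivariant_def cylinder_action_def)
  show ?thesis
    unfolding G_homotopic_def
    by (subst homotopic_with, erule equivariant_cong[OF assms]) (auto simp: stages G_map_def)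
qed

lemma G_homotopic_compose_right:
  assumes "G_homotopic G Y b Z c f0 f1" and k: "G_map G X a Y b k"
  shows "G_homotopic G X a Z c (f0 \<circ> k) (f1 \<circ> k)"
  unfolding G_homotopic_def
proof (rule homotopic_with_compose_continuous_map_right)
  show "homotopic_with (equivariant G Y b c) Y Z f0 f1"
    using assms(1) by (simp add: G_homotopic_def)
  show "continuous_map X Y k" using k by (simp add: G_map_def)
  show "equivariant G X a c (j \<circ> k)" if "equivariant G Y b c j" for j
    using that k by (auto simp: equivariant_def G_map_def continuous_map_def Pi_iff)
qed

text \<open>Liftability along a fibration is invariant under homotopy: the lift of the homotopy ends in
  a lift of its last stage.\<close>

lemma G_homotopic_lift:
  assumes G: "topological_group G T" and p: "G_fibration G T E aE B aB p" and X: "G_space G T X a"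
    and hom: "G_homotopic G X a B aB f0 f1"
    and k0: "G_map G X a E aE k0" "\<And>x. x \<in> topspace X \<Longrightarrow> p (k0 x) = f0 x"
  obtains k1 where "G_map G X a E aE k1" "\<And>x. x \<in> topspace X \<Longrightarrow> p (k1 x) = f1 x"
proof -
  obtain h where h: "G_map G (prod_topology unit_interval X) (cylinder_action a) B aB h"
      "\<And>x. x \<in> topspace X \<Longrightarrow> h (0, x) = f0 x" "\<And>x. x \<in> topspace X \<Longrightarrow> h (1, x) = f1 x"
    using hom unfolding G_homotopic_iff[OF G X] by blast
  then have "\<forall>x \<in> topspace X. h (0, x) = p (k0 x)" using k0(2) by simp
  then obtain k where k: "G_map G (prod_topology unit_interval X) (cylinder_action a) E aE k"
      "\<forall>t \<in> {0..1}. \<forall>x \<in> topspace X. p (k (t, x)) = h (t, x)"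
    using G_fibration_imp_G_homotopy_lifting[OF G p] X k0(1) h(1)
    unfolding G_homotopy_lifting_def by blast
  have end_map: "G_map G X a (prod_topology unit_interval X) (cylinder_action a) (\<lambda>x. (1, x))"
    by (auto simp: G_map_def equivariant_def cylinder_action_def intro!: continuous_map_pairedI)
  show thesis
  proof (rule that)
    show "G_map G X a E aE (k \<circ> (\<lambda>x. (1, x)))" by (rule G_map_compose[OF end_map k(1)])
  qed (use k(2) h(3) in auto)
qed


section \<open>Broken fibrewise paths\<close>

lemma image_orbit:
  assumes "equivariant G X a b f" "x \<in> topspace X"
  shows "f ` orbit G a x = orbit G b (f x)"
  using assms by (force simp: orbit_def equivariant_def)

lemma continuous_map_fibre_path_evaluation:
  "continuous_map (prod_topology unit_interval (fibre_paths E B p)) E (\<lambda>(t, \<gamma>). \<gamma> t)"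
  unfolding fibre_paths_def prod_topology_subtopology(2)
  by (intro continuous_map_from_subtopology continuous_map_path_evaluation)

lemma continuous_map_const_fibre_path:
  assumes p: "continuous_map E B p"
  shows "continuous_map E (fibre_paths E B p) (\<lambda>e. \<lambda>t\<in>{0..1}. e)"
proof -
  have "continuous_map E (path_space E) (\<lambda>e. \<lambda>t\<in>{0..1}. e)"
    using continuous_map_curry[of unit_interval E E snd, OF continuous_map_snd] by simp
  then show ?thesis
    using continuous_map_image_subset_topspace[OF p]
    by (auto simp: fibre_paths_def continuous_map_in_subtopology image_subset_iff)
qed

text \<open>As \<open>\<gamma>\<close> and \<open>\<delta>\<close> stay in fibres, \<open>\<gamma> s\<close> and \<open>\<delta> t\<close> lie over the same points as \<open>\<gamma> 1\<close> and \<open>\<delta> 0\<close>,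
  whose common orbit in \<open>E\<close> is mapped to one orbit in \<open>B\<close>. This keeps the shrinking homotopy in
  \<open>E \<times>\<^bsub>B/G\<^esub> E\<close>.\<close>

lemma broken_fibre_path_points:
  assumes p: "G_map G E aE B aB p"
    and w: "(\<gamma>, \<delta>) \<in> topspace (broken_fibre_paths G E aE B p)"
    and st: "s \<in> {0..1}" "t \<in> {0..1}"
  shows "(\<gamma> s, \<delta> t) \<in> topspace (same_base_orbit G E aB p)"
proof -
  have in_E: "\<gamma> r \<in> topspace E" "\<delta> r \<in> topspace E" if "r \<in> {0..1}" for r
    using w that
    by (auto simp: broken_fibre_paths_def fibre_paths_def continuous_maps_def continuous_map_def Pi_iff)
  have "p (\<gamma> s) = p (\<gamma> 1)" "p (\<delta> t) = p (\<delta> 0)"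
    using w st by (auto simp: broken_fibre_paths_def fibre_paths_def)
  moreover have "orbit G aB (p (\<gamma> 1)) = orbit G aB (p (\<delta> 0))"
    using w p in_E image_orbit[of G E aE aB p "\<gamma> 1"] image_orbit[of G E aE aB p "\<delta> 0"]
    by (simp add: broken_fibre_paths_def G_map_def)
  ultimately show ?thesis
    using in_E st by (simp add: same_base_orbit_def)
qed

lemma Psi_G_homotopic_midpoints:
  assumes GG: "topological_group (G \<times>\<times> G) TT"
    and broken: "G_space (G \<times>\<times> G) TT (broken_fibre_paths G E aE B p)
          (prod_action (path_action aE) (path_action aE))"
    and p: "G_map G E aE B aB p"
  shows "G_homotopic (G \<times>\<times> G)
      (broken_fibre_paths G E aE B p) (prod_action (path_action aE) (path_action aE))
      (same_base_orbit G E aB p) (prod_action aE aE) Psi (\<lambda>(\<gamma>, \<delta>). (\<gamma> 1, \<delta> 0))"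
  unfolding G_homotopic_iff[OF GG broken]
proof (intro exI conjI ballI)
  let ?W = "broken_fibre_paths G E aE B p"
  let ?IW = "prod_topology unit_interval ?W"
  let ?h = "\<lambda>(t, (\<gamma>, \<delta>)). (\<gamma> t, \<delta> (1 - t))"
  have W: "continuous_map ?W (fibre_paths E B p) fst" "continuous_map ?W (fibre_paths E B p) snd"
    unfolding broken_fibre_paths_def
    by (intro continuous_map_from_subtopology continuous_map_fst continuous_map_snd)+
  have flip: "continuous_map unit_interval unit_interval (\<lambda>t::real. 1 - t)"
    by (auto simp: continuous_map_in_subtopology intro!: continuous_intros)
  have "continuous_map ?IW (prod_topology unit_interval (fibre_paths E B p)) (\<lambda>w. (fst w, (fst \<circ> snd) w))"
    by (intro continuous_map_pairedI continuous_map_fst continuous_map_compose[OF continuous_map_snd W(1)])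
  note c1 = continuous_map_compose[OF this continuous_map_fibre_path_evaluation]
  have "continuous_map ?IW (prod_topology unit_interval (fibre_paths E B p))
      (\<lambda>w. (((\<lambda>t. 1 - t) \<circ> fst) w, (snd \<circ> snd) w))"
    by (intro continuous_map_pairedI continuous_map_compose[OF continuous_map_fst flip]
        continuous_map_compose[OF continuous_map_snd W(2)])
  note c2 = continuous_map_compose[OF this continuous_map_fibre_path_evaluation]
  have "continuous_map ?IW (prod_topology E E) ?h"
    using continuous_map_pairedI[OF c1 c2] by (simp add: o_def case_prod_unfold)
  moreover have "?h w \<in> topspace (same_base_orbit G E aB p)" if "w \<in> topspace ?IW" for w
    using that broken_fibre_path_points[OF p] by auto
  ultimately have "continuous_map ?IW (same_base_orbit G E aB p) ?h"
    by (auto simp: same_base_orbit_def continuous_map_in_subtopology)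
  then show "G_map (G \<times>\<times> G) ?IW (cylinder_action (prod_action (path_action aE) (path_action aE)))
      (same_base_orbit G E aB p) (prod_action aE aE) ?h"
    by (auto simp: G_map_def equivariant_def cylinder_action_def prod_action_def path_action_def)
qed (auto simp: Psi_def)

lemma G_map_const_paths:
  assumes p: "continuous_map E B p"
    and E: "\<And>g e. \<lbrakk>g \<in> carrier G; e \<in> topspace E\<rbrakk> \<Longrightarrow> aE g e \<in> topspace E"
  shows "G_map (G \<times>\<times> G) (same_orbit G E aE) (prod_action aE aE)
      (broken_fibre_paths G E aE B p) (prod_action (path_action aE) (path_action aE))
      (\<lambda>(e1, e2). (\<lambda>t\<in>{0..1}. e1, \<lambda>t\<in>{0..1}. e2))"
proof -
  let ?c = "\<lambda>e. \<lambda>t\<in>{0..1::real}. e"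
  let ?O = "same_orbit G E aE"
  have O: "continuous_map ?O E fst" "continuous_map ?O E snd"
    unfolding same_orbit_def
    by (intro continuous_map_from_subtopology continuous_map_fst continuous_map_snd)+
  note c = continuous_map_compose[OF _ continuous_map_const_fibre_path[OF p]]
  have "continuous_map ?O (broken_fibre_paths G E aE B p) (\<lambda>(e1, e2). (?c e1, ?c e2))"
    using continuous_map_pairedI[OF c[OF O(1)] c[OF O(2)]]
    by (auto simp: broken_fibre_paths_def continuous_map_in_subtopology same_orbit_def
        o_def case_prod_unfold)
  then show ?thesis
    by (auto simp: G_map_def equivariant_def prod_action_def path_action_def fun_eq_iff)
qed


section \<open>Equivariant sections and deformations\<close>

theorem theorem4p6:
  fixes G :: "('g, 'm) monoid_scheme" and T :: "'g topology"
    and E :: "'e topology" and aE :: "'g \<Rightarrow> 'e \<Rightarrow> 'e"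
    and B :: "'b topology" and aB :: "'g \<Rightarrow> 'b \<Rightarrow> 'b"
    and p :: "'e \<Rightarrow> 'b" and U :: "('e \<times> 'e) set"
  assumes "topological_group G T"
    and "G_fibration G T E aE B aB p"
    and "G_fibration (G \<times>\<times> G) (prod_topology T T)
           (broken_fibre_paths G E aE B p) (prod_action (path_action aE) (path_action aE))
           (same_base_orbit G E aB p) (prod_action aE aE) Psi"
    and "U \<subseteq> topspace (same_base_orbit G E aB p)"
    and "G_invariant (G \<times>\<times> G) (prod_action aE aE) U"
  shows "(\<exists>\<sigma>. G_map (G \<times>\<times> G)
                (subtopology (same_base_orbit G E aB p) U) (prod_action aE aE)
                (broken_fibre_paths G E aE B p) (prod_action (path_action aE) (path_action aE)) \<sigma> \<and>
              (\<forall>u \<in> U. Psi (\<sigma> u) = u))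
     \<longleftrightarrow>
         (\<exists>f. G_map (G \<times>\<times> G)
                (subtopology (same_base_orbit G E aB p) U) (prod_action aE aE)
                (same_base_orbit G E aB p) (prod_action aE aE) f \<and>
              f ` U \<subseteq> topspace (same_orbit G E aE) \<and>
              G_homotopic (G \<times>\<times> G)
                (subtopology (same_base_orbit G E aB p) U) (prod_action aE aE)
                (same_base_orbit G E aB p) (prod_action aE aE) (\<lambda>u. u) f)"
    (is "(\<exists>\<sigma>. G_map ?GG ?U ?a ?W ?aW \<sigma> \<and> _ \<sigma>) \<longleftrightarrow> _")
proof -
  let ?Y = "same_base_orbit G E aB p"
  have GG: "topological_group ?GG (prod_topology T T)"
    using topological_group_DirProd[OF assms(1) assms(1)] .
  have E: "G_space G T E aE" and p: "G_map G E aE B aB p"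
    using assms(2) by (auto simp: G_fibration_def)
  have W: "G_space ?GG (prod_topology T T) ?W ?aW" and Y: "G_space ?GG (prod_topology T T) ?Y ?a"
    using assms(3) by (auto simp: G_fibration_def)
  have U: "G_space ?GG (prod_topology T T) ?U ?a"
    using assms(5) by (intro G_space_subtopology[OF GG Y]) (auto simp: G_invariant_def)
  have topU: "topspace ?U = U"
    using assms(4) by auto
  show ?thesis
  proof
    assume "\<exists>\<sigma>. G_map ?GG ?U ?a ?W ?aW \<sigma> \<and> (\<forall>u \<in> U. Psi (\<sigma> u) = u)"
    then obtain \<sigma> where \<sigma>: "G_map ?GG ?U ?a ?W ?aW \<sigma>" "\<And>u. u \<in> U \<Longrightarrow> Psi (\<sigma> u) = u" by blast
    let ?f = "(\<lambda>(\<gamma>, \<delta>). (\<gamma> 1, \<delta> 0)) \<circ> \<sigma>"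
    have hom: "G_homotopic ?GG ?U ?a ?Y ?a (Psi \<circ> \<sigma>) ?f"
      by (rule G_homotopic_compose_right[OF Psi_G_homotopic_midpoints[OF GG W p] \<sigma>(1)])
    show "\<exists>f. G_map ?GG ?U ?a ?Y ?a f \<and> f ` U \<subseteq> topspace (same_orbit G E aE) \<and>
        G_homotopic ?GG ?U ?a ?Y ?a (\<lambda>u. u) f"
    proof (intro exI conjI)
      show "G_map ?GG ?U ?a ?Y ?a ?f"
        using hom homotopic_with_imp_continuous_maps homotopic_with_imp_property
        unfolding G_homotopic_def G_map_def by blast
      have "\<sigma> u \<in> topspace ?W" if "u \<in> U" for u
        using \<sigma>(1) that topU by (auto simp: G_map_def continuous_map_def Pi_iff)
      then show "?f ` U \<subseteq> topspace (same_orbit G E aE)"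
        by (fastforce simp: same_orbit_def broken_fibre_paths_def fibre_paths_def
            continuous_maps_def continuous_map_def Pi_iff)
      show "G_homotopic ?GG ?U ?a ?Y ?a (\<lambda>u. u) ?f"
        using hom \<sigma>(2) topU unfolding G_homotopic_iff[OF GG U] by auto
    qed
  next
    assume "\<exists>f. G_map ?GG ?U ?a ?Y ?a f \<and> f ` U \<subseteq> topspace (same_orbit G E aE) \<and>
        G_homotopic ?GG ?U ?a ?Y ?a (\<lambda>u. u) f"
    then obtain f where f: "G_map ?GG ?U ?a ?Y ?a f" "f ` U \<subseteq> topspace (same_orbit G E aE)"
      and hom: "G_homotopic ?GG ?U ?a ?Y ?a (\<lambda>u. u) f" by blast
    have "continuous_map ?U (prod_topology E E) f"
      using f(1) by (simp add: G_map_def same_base_orbit_def continuous_map_in_subtopology)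
    then have fO: "G_map ?GG ?U ?a (same_orbit G E aE) ?a f"
      using f topU by (auto simp: G_map_def same_orbit_def continuous_map_in_subtopology)
    let ?c = "\<lambda>(e1, e2). (\<lambda>t\<in>{0..1::real}. e1, \<lambda>t\<in>{0..1::real}. e2)"
    have c: "G_map ?GG (same_orbit G E aE) ?a ?W ?aW ?c"
      using p G_space_action_closed[OF assms(1) E] by (intro G_map_const_paths) (auto simp: G_map_def)
    have "G_homotopic ?GG ?U ?a ?Y ?a f (\<lambda>u. u)"
      using hom unfolding G_homotopic_def by (rule homotopic_with_symD)
    moreover have "Psi ((?c \<circ> f) u) = f u" for u
      by (simp add: Psi_def case_prod_unfold)
    ultimately obtain \<sigma> where "G_map ?GG ?U ?a ?W ?aW \<sigma>" "\<And>u. u \<in> topspace ?U \<Longrightarrow> Psi (\<sigma> u) = u"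
      using G_homotopic_lift[OF GG assms(3) U _ G_map_compose[OF fO c]] by blast
    then show "\<exists>\<sigma>. G_map ?GG ?U ?a ?W ?aW \<sigma> \<and> (\<forall>u \<in> U. Psi (\<sigma> u) = u)"
      using topU by blast
  qed
qed

end
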